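(* Let $\mathcal{A},\mathcal{B}\in\mathbb{C}^{I_1\times\cdots\times I_N\times I_1\times\cdots\times I_N}$, and let $\mathcal{M},\mathcal{N}\in\mathbb{C}^{I_1\times\cdots\times I_N\times I_1\times\cdots\times I_N}$ be Hermitian positive definite tensors. If (i) $\mathcal{A}*_N(\mathcal{B}*_N\mathcal{B}^{\dagger}_{\mathcal{M}\mathcal{N}})=(\mathcal{B}*_N\mathcal{B}^{\dagger}_{\mathcal{M}\mathcal{N}})*_N\mathcal{A}$, (ii) $\mathcal{A}^{\dagger}_{\mathcal{M}\mathcal{N}}*_N(\mathcal{B}*_N\mathcal{B}^{\dagger}_{\mathcal{M}\mathcal{N}})=(\mathcal{B}*_N\mathcal{B}^{\dagger}_{\mathcal{M}\mathcal{N}})*_N\mathcal{A}^{\dagger}_{\mathcal{M}\mathcal{N}}$, and (iii) $(\mathcal{N}*_N\mathcal{B}^{\dagger}_{\mathcal{M}\mathcal{N}}*_N\mathcal{A}^{\dagger}_{\mathcal{M}\mathcal{N}}*_N\mathcal{A}*_N\mathcal{B})^H=\mathcal{N}*_N\mathcal{B}^{\dagger}_{\mathcal{M}\mathcal{N}}*_N\mathcal{A}^{\dagger}_{\mathcal{M}\mathcal{N}}*_N\mathcal{A}*_N\mathcal{B}$, then $(\mathcal{A}*_N\mathcal{B})^{\dagger}_{\mathcal{M}\mathcal{N}}=\mathcal{B}^{\dagger}_{\mathcal{M}\mathcal{N}}*_N\mathcal{A}^{\dagger}_{\mathcal{M}\mathcal{N}}$.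
   Context: For tensors $\mathcal{A},\mathcal{B}\in\mathbb{C}^{I_1\times\cdots\times I_N\times I_1\times\cdots\times I_N}$ the Einstein product is $(\mathcal{A}*_N\mathcal{B})_{i_1\cdots i_Nk_1\cdots k_N}=\sum_{j_1,\dots,j_N}a_{i_1\cdots i_Nj_1\cdots j_N}b_{j_1\cdots j_Nk_1\cdots k_N}$. The conjugate transpose is $(\mathcal{A}^H)_{j_1\cdots j_Ni_1\cdots i_N}=\overline{a_{i_1\cdots i_Nj_1\cdots j_N}}$. The identity tensor $\mathcal{I}$ has entries $\prod_{k}\delta_{i_kj_k}$; $\mathcal{U}$ is unitary if $\mathcal{U}*_N\mathcal{U}^H=\mathcal{U}^H*_N\mathcal{U}=\mathcal{I}$; $\mathcal{D}$ is diagonal if $d_{i_1\cdots i_Nj_1\cdots j_N}=0$ whenever $(i_1,\dots,i_N)\ne(j_1,\dots,j_N)$. A tensor $\mathcal{P}$ is Hermitian positive definite if $\mathcal{P}=\mathcal{U}*_N\mathcal{D}*_N\mathcal{U}^H$ with $\mathcal{U}$ unitary and $\mathcal{D}$ diagonal with positive diagonal entries. For Hermitian positive definite $\mathcal{M},\mathcal{N}$, the weighted Moore--Penrose inverse $\mathcal{A}^{\dagger}_{\mathcal{M}\mathcal{N}}$ is the unique tensor $\mathcal{X}\in\mathbb{C}^{I_1\times\cdots\times I_N\times I_1\times\cdots\times I_N}$ satisfying $\mathcal{A}*_N\mathcal{X}*_N\mathcal{A}=\mathcal{A}$, $\mathcal{X}*_N\mathcal{A}*_N\mathcal{X}=\mathcal{X}$,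 $(\mathcal{M}*_N\mathcal{A}*_N\mathcal{X})^H=\mathcal{M}*_N\mathcal{A}*_N\mathcal{X}$, $(\mathcal{N}*_N\mathcal{X}*_N\mathcal{A})^H=\mathcal{N}*_N\mathcal{X}*_N\mathcal{A}$. *)

theory Defs
  imports Complex_Main
begin

text \<open>
  A tensor in \<open>\<complex>\<close> of shape \<open>I\<^sub>1 \<times> \<dots> \<times> I\<^sub>N \<times> I\<^sub>1 \<times> \<dots> \<times> I\<^sub>N\<close> is a function of its row
  multi-index and its column multi-index. The list \<open>I = [I\<^sub>1, \<dots>, I\<^sub>N]\<close> holds the dimensions,
  so \<open>N = length I\<close>; indices count from 0. Tensors vanish off the index range, so that
  equality of tensors is equality of functions.
\<close>

type_synonym tensor = "nat list \<Rightarrow> nat list \<Rightarrow> complex"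

definition multi_indices :: "nat list \<Rightarrow> nat list set" where
  "multi_indices I = {i. length i = length I \<and> (\<forall>k<length I. i ! k < I ! k)}"

definition tensors :: "nat list \<Rightarrow> tensor set" where
  "tensors I = {A. \<forall>i j. i \<notin> multi_indices I \<or> j \<notin> multi_indices I \<longrightarrow> A i j = 0}"

definition einstein_product :: "tensor \<Rightarrow> nat list \<Rightarrow> tensor \<Rightarrow> tensor"
    ("(_ \<star>\<^bsub>_\<^esub> _)" [70, 0, 71] 70) where
  "A \<star>\<^bsub>I\<^esub> B = (\<lambda>i k. \<Sum>j\<in>multi_indices I. A i j * B j k)"

definition conj_transpose :: "tensor \<Rightarrow> tensor" where
  "conj_transpose A = (\<lambda>j i. cnj (A i j))"

definition identity_tensor :: "nat list \<Rightarrow> tensor" where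
  "identity_tensor I = (\<lambda>i j.
     if i \<in> multi_indices I \<and> j \<in> multi_indices I
     then \<Prod>k<length I. (if i ! k = j ! k then 1 else 0) else 0)"

definition unitary_tensor :: "nat list \<Rightarrow> tensor \<Rightarrow> bool" where
  "unitary_tensor I U \<longleftrightarrow> U \<in> tensors I \<and>
     U \<star>\<^bsub>I\<^esub> conj_transpose U = identity_tensor I \<and>
     conj_transpose U \<star>\<^bsub>I\<^esub> U = identity_tensor I"

definition diagonal_tensor :: "nat list \<Rightarrow> tensor \<Rightarrow> bool" where
  "diagonal_tensor I D \<longleftrightarrow> D \<in> tensors I \<and>
     (\<forall>i\<in>multi_indices I. \<forall>j\<in>multi_indices I. i \<noteq> j \<longrightarrow> D i j = 0)"

definition hermitian_positive_definite :: "nat list \<Rightarrow> tensor \<Rightarrow> bool" where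
  "hermitian_positive_definite I P \<longleftrightarrow>
     (\<exists>U D. unitary_tensor I U \<and> diagonal_tensor I D \<and>
       (\<forall>i\<in>multi_indices I. \<exists>r::real. r > 0 \<and> D i i = of_real r) \<and>
       P = U \<star>\<^bsub>I\<^esub> D \<star>\<^bsub>I\<^esub> conj_transpose U)"

definition is_weighted_mp_inverse ::
    "nat list \<Rightarrow> tensor \<Rightarrow> tensor \<Rightarrow> tensor \<Rightarrow> tensor \<Rightarrow> bool" where
  "is_weighted_mp_inverse I M N A X \<longleftrightarrow> X \<in> tensors I \<and>
     A \<star>\<^bsub>I\<^esub> X \<star>\<^bsub>I\<^esub> A = A \<and>
     X \<star>\<^bsub>I\<^esub> A \<star>\<^bsub>I\<^esub> X = X \<and>
     conj_transpose (M \<star>\<^bsub>I\<^esub> A \<star>\<^bsub>I\<^esub> X) = M \<star>\<^bsub>I\<^esub> A \<star>\<^bsub>I\<^esub> X \<and>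
     conj_transpose (N \<star>\<^bsub>I\<^esub> X \<star>\<^bsub>I\<^esub> A) = N \<star>\<^bsub>I\<^esub> X \<star>\<^bsub>I\<^esub> A"

definition weighted_mp_inverse ::
    "nat list \<Rightarrow> tensor \<Rightarrow> tensor \<Rightarrow> tensor \<Rightarrow> tensor" where
  "weighted_mp_inverse I M N A = (THE X. is_weighted_mp_inverse I M N A X)"

end

theory Submission
  imports Defs "HOL-Library.Function_Algebras"
begin

text \<open>
  The theorem needs the weighted Moore-Penrose inverses of \<open>A\<close> and \<open>B\<close> to exist, and that of
  \<open>A B\<close> to be unique. For existence, every tensor \<open>C\<close> has an inner inverse \<open>Y\<close>, \<open>C Y C = C\<close>,
  by splitting a linear map. If \<open>Y\<close> is an inner inverse of \<open>A\<^sup>H M A\<close>, then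
  positive definiteness of \<open>M\<close> allows \<open>A\<^sup>H M\<close> to be cancelled and \<open>Y\<^sub>1 = Y A\<^sup>H M\<close> satisfies
  \<open>A Y\<^sub>1 A = A\<close> with \<open>M A Y\<^sub>1\<close> Hermitian. Applied to \<open>A\<^sup>H\<close> and \<open>N\<^sup>-\<^sup>1\<close>, the same construction gives
  \<open>Z\<^sub>1\<close> with \<open>A Z\<^sub>1 A = A\<close> and \<open>N Z\<^sub>1 A\<close> Hermitian, and \<open>Z\<^sub>1 A Y\<^sub>1\<close> is the inverse.
  The reverse order law is then a computation in which \<open>B B\<^sup>\<dagger>\<close> is moved past \<open>A\<close> and \<open>A\<^sup>\<dagger>\<close>.
\<close>

section \<open>Multi-indices and the algebra of the Einstein product\<close>

text \<open>Each dimension is at most the sum of all dimensions, so multi-indices are lists of one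
  fixed length over a single finite alphabet. Finiteness is what lets sums with a Kronecker delta
  collapse to one term.\<close>

lemma finite_multi_indices: "finite (multi_indices I)"
proof (rule finite_subset)
  show "multi_indices I \<subseteq> {xs. set xs \<subseteq> {..<Suc (sum_list I)} \<and> length xs = length I}"
  proof
    fix i assume "i \<in> multi_indices I"
    then have "length i = length I" and lt: "\<And>k. k < length I \<Longrightarrow> i ! k < I ! k"
      by (auto simp: multi_indices_def)
    moreover have "i ! k < Suc (sum_list I)" if "k < length I" for k
      using lt[OF that] elem_le_sum_list[OF that] by linarith
    ultimately show "i \<in> {xs. set xs \<subseteq> {..<Suc (sum_list I)} \<and> length xs = length I}"
      by (auto simp: in_set_conv_nth)
  qed
  show "finite {xs. set xs \<subseteq> {..<Suc (sum_list I)} \<and> length xs = length I}"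
    by (rule finite_lists_length_eq) simp
qed

text \<open>Two distinct lists of equal length differ at some position, and the factor there kills
  the product of deltas.\<close>

lemma identity_tensor_eq:
  "identity_tensor I = (\<lambda>i j. if i = j \<and> i \<in> multi_indices I then 1 else 0)"
proof (intro ext)
  fix i j
  have "(\<Prod>k<length I. (if i ! k = j ! k then 1 else 0)) = (if i = j then 1 else 0 :: complex)"
    if "i \<in> multi_indices I" "j \<in> multi_indices I"
  proof (cases "i = j")
    case False
    have "length i = length I" "length j = length I"
      using that by (auto simp: multi_indices_def)
    with False obtain k where "k < length I" "i ! k \<noteq> j ! k"
      by (metis nth_equalityI)
    then show ?thesis using False by (auto intro!: prod_zero)
  qed simp
  then show "identity_tensor I i j = (if i = j \<and> i \<in> multi_indices I then 1 else 0)"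
    by (auto simp: identity_tensor_def)
qed

lemma einstein_product_assoc: "A \<star>\<^bsub>I\<^esub> B \<star>\<^bsub>I\<^esub> C = A \<star>\<^bsub>I\<^esub> (B \<star>\<^bsub>I\<^esub> C)"
proof (intro ext)
  fix i k
  have "(A \<star>\<^bsub>I\<^esub> B \<star>\<^bsub>I\<^esub> C) i k
      = (\<Sum>j\<in>multi_indices I. \<Sum>l\<in>multi_indices I. A i l * (B l j * C j k))"
    by (simp add: einstein_product_def sum_distrib_right mult.assoc)
  also have "\<dots> = (\<Sum>l\<in>multi_indices I. \<Sum>j\<in>multi_indices I. A i l * (B l j * C j k))"
    by (rule sum.swap)
  also have "\<dots> = (A \<star>\<^bsub>I\<^esub> (B \<star>\<^bsub>I\<^esub> C)) i k"
    by (simp add: einstein_product_def sum_distrib_left)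
  finally show "(A \<star>\<^bsub>I\<^esub> B \<star>\<^bsub>I\<^esub> C) i k = (A \<star>\<^bsub>I\<^esub> (B \<star>\<^bsub>I\<^esub> C)) i k" .
qed

lemma conj_transpose_product:
  "conj_transpose (A \<star>\<^bsub>I\<^esub> B) = conj_transpose B \<star>\<^bsub>I\<^esub> conj_transpose A"
  by (simp add: conj_transpose_def einstein_product_def mult.commute)

lemma conj_transpose_conj_transpose [simp]: "conj_transpose (conj_transpose A) = A"
  by (simp add: conj_transpose_def)

lemma einstein_product_diff_right: "A \<star>\<^bsub>I\<^esub> (B - C) = A \<star>\<^bsub>I\<^esub> B - A \<star>\<^bsub>I\<^esub> C"
  by (simp add: einstein_product_def fun_eq_iff right_diff_distrib sum_subtractf)

lemma einstein_product_zero_right [simp]: "A \<star>\<^bsub>I\<^esub> 0 = 0"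
  by (simp add: einstein_product_def fun_eq_iff)

lemma einstein_product_in_tensors [intro, simp]:
  "A \<in> tensors I \<Longrightarrow> B \<in> tensors I \<Longrightarrow> A \<star>\<^bsub>I\<^esub> B \<in> tensors I"
  by (auto simp: tensors_def einstein_product_def)

lemma conj_transpose_in_tensors [intro, simp]: "A \<in> tensors I \<Longrightarrow> conj_transpose A \<in> tensors I"
  by (auto simp: tensors_def conj_transpose_def)

lemma diff_in_tensors [intro, simp]: "A \<in> tensors I \<Longrightarrow> B \<in> tensors I \<Longrightarrow> A - B \<in> tensors I"
  by (auto simp: tensors_def)

lemma identity_in_tensors [intro, simp]: "identity_tensor I \<in> tensors I"
  by (auto simp: tensors_def identity_tensor_def)

lemma conj_transpose_identity [simp]: "conj_transpose (identity_tensor I) = identity_tensor I"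
  by (auto simp: conj_transpose_def identity_tensor_eq fun_eq_iff)

lemma identity_product_left [simp]:
  assumes "A \<in> tensors I"
  shows "identity_tensor I \<star>\<^bsub>I\<^esub> A = A"
proof (intro ext)
  fix i k
  show "(identity_tensor I \<star>\<^bsub>I\<^esub> A) i k = A i k"
  proof (cases "i \<in> multi_indices I")
    case True
    have "(identity_tensor I \<star>\<^bsub>I\<^esub> A) i k
        = (\<Sum>j\<in>multi_indices I. if i = j then A j k else 0)"
      unfolding einstein_product_def using True
      by (intro sum.cong) (auto simp: identity_tensor_eq)
    with True show ?thesis by (simp add: finite_multi_indices)
  next
    case False
    with assms show ?thesis
      by (auto simp: einstein_product_def identity_tensor_eq tensors_def)
  qed
qed

text \<open>The left law for \<open>A\<^sup>H\<close>, conjugate transposed.\<close>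

lemma identity_product_right [simp]:
  assumes "A \<in> tensors I"
  shows "A \<star>\<^bsub>I\<^esub> identity_tensor I = A"
  using arg_cong[OF identity_product_left[OF conj_transpose_in_tensors[OF assms]],
      of conj_transpose]
  by (simp add: conj_transpose_product)

section \<open>Inner inverses\<close>

text \<open>\<open>A\<close> acts as a linear map \<open>f\<close> on complex-valued functions of
  lists. Over a field there is a linear \<open>g\<close> that inverts \<open>f\<close> on its range,
  so \<open>f g f = f\<close>. The matrix of \<open>g\<close> on unit vectors, cut to the index
  range, is \<open>Y\<close>.\<close>

lemma inner_inverse_exists:
  assumes A: "A \<in> tensors I"
  shows "\<exists>Y\<in>tensors I. A \<star>\<^bsub>I\<^esub> Y \<star>\<^bsub>I\<^esub> A = A"
proof -
  define s :: "complex \<Rightarrow> (nat list \<Rightarrow> complex) \<Rightarrow> nat list \<Rightarrow> complex"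
    where "s = (\<lambda>c v i. c * v i)"
  define f where "f = (\<lambda>v i. \<Sum>j\<in>multi_indices I. A i j * v j)"
  define e :: "nat list \<Rightarrow> nat list \<Rightarrow> complex" where "e = (\<lambda>j i. if i = j then 1 else 0)"
  interpret vector_space s
    by unfold_locales (auto simp: s_def fun_eq_iff algebra_simps)
  interpret vector_space_pair s s ..
  have f: "Vector_Spaces.linear s s f"
    unfolding Vector_Spaces.linear_iff
    by (intro conjI vector_space_axioms)
      (auto simp: f_def s_def fun_eq_iff algebra_simps sum.distrib sum_distrib_left)
  obtain g where g: "Vector_Spaces.linear s s g" "\<And>v. f (g (f v)) = f v"
    using linear_exists_right_inverse_on[OF f subspace_UNIV] by auto
  interpret g: Vector_Spaces.linear s s g by (rule g)
  define Y where
    "Y = (\<lambda>i j. if i \<in> multi_indices I \<and> j \<in> multi_indices I then g (e j) i else 0)"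
  have sum_apply: "(\<Sum>j\<in>S. h j) i = (\<Sum>j\<in>S. h j i)"
    for S :: "nat list set" and h :: "nat list \<Rightarrow> nat list \<Rightarrow> complex" and i
    by (induction S rule: infinite_finite_induct) auto
  have "(A \<star>\<^bsub>I\<^esub> (Y \<star>\<^bsub>I\<^esub> A)) i c = A i c" for i c
  proof (cases "c \<in> multi_indices I")
    case True
    have col: "f (e c) = (\<lambda>j. A j c)"
      unfolding f_def e_def using True by (simp add: finite_multi_indices if_distrib cong: if_cong)
    \<comment> \<open>The image \<open>f (e c)\<close> is column \<open>c\<close> of
      \<open>A\<close>. Since \<open>A\<close> vanishes off the index range, it is a finite
      combination of unit vectors, so linearity expresses \<open>g\<close> on it through the columns
      of \<open>Y\<close>.\<close>
    have "f (e c) = (\<Sum>j\<in>multi_indices I. s (A j c) (e j))"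
    proof
      fix k
      have "(\<Sum>j\<in>multi_indices I. s (A j c) (e j)) k
          = (\<Sum>j\<in>multi_indices I. if j = k then A j c else 0)"
        unfolding sum_apply by (intro sum.cong) (auto simp: s_def e_def)
      also have "\<dots> = A k c"
        using A by (auto simp: finite_multi_indices tensors_def)
      finally show "f (e c) k = (\<Sum>j\<in>multi_indices I. s (A j c) (e j)) k"
        by (simp add: col)
    qed
    then have "g (f (e c)) = (\<Sum>j\<in>multi_indices I. s (A j c) (g (e j)))"
      by (simp add: g.sum g.scale)
    then have "(Y \<star>\<^bsub>I\<^esub> A) k c = g (f (e c)) k" if "k \<in> multi_indices I" for k
      unfolding einstein_product_def using that
      by (simp add: sum_apply Y_def s_def mult.commute)
    \<comment> \<open>The map \<open>f\<close> reads its argument at multi-indices only, so the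
      truncation in \<open>Y\<close> changes nothing.\<close>
    then have "(A \<star>\<^bsub>I\<^esub> (Y \<star>\<^bsub>I\<^esub> A)) i c = f (g (f (e c))) i"
      by (simp add: einstein_product_def[of A] f_def)
    then show ?thesis by (simp only: g(2)) (simp only: col)
  next
    case False
    with A show ?thesis by (simp add: einstein_product_def tensors_def)
  qed
  then have "A \<star>\<^bsub>I\<^esub> Y \<star>\<^bsub>I\<^esub> A = A"
    by (simp add: einstein_product_assoc fun_eq_iff)
  moreover have "Y \<in> tensors I"
    by (auto simp: tensors_def Y_def)
  ultimately show ?thesis by blast
qed

section \<open>Hermitian positive definite tensors\<close>

lemma diagonal_product_left:
  assumes "diagonal_tensor I D" "i \<in> multi_indices I"
  shows "(D \<star>\<^bsub>I\<^esub> A) i k = D i i * A i k"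
proof -
  have "(D \<star>\<^bsub>I\<^esub> A) i k = (\<Sum>j\<in>multi_indices I. if i = j then D i i * A i k else 0)"
    unfolding einstein_product_def using assms
    by (intro sum.cong) (auto simp: diagonal_tensor_def)
  with assms show ?thesis by (simp add: finite_multi_indices)
qed

lemma hermitian_positive_definite_conj_transpose:
  assumes "hermitian_positive_definite I P"
  shows "conj_transpose P = P"
proof -
  obtain U D where D: "diagonal_tensor I D"
    and pos: "\<And>i. i \<in> multi_indices I \<Longrightarrow> \<exists>r::real. r > 0 \<and> D i i = of_real r"
    and P: "P = U \<star>\<^bsub>I\<^esub> D \<star>\<^bsub>I\<^esub> conj_transpose U"
    using assms by (auto simp: hermitian_positive_definite_def)
  have "cnj (D j i) = D i j" for i j
  proof (cases "i = j \<and> i \<in> multi_indices I")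
    case True
    with pos[of i] show ?thesis by auto
  next
    case False
    with D have "D i j = 0" "D j i = 0"
      by (cases "i \<in> multi_indices I \<and> j \<in> multi_indices I";
          auto simp: diagonal_tensor_def tensors_def)+
    then show ?thesis by simp
  qed
  then have "conj_transpose D = D" by (simp add: conj_transpose_def)
  then show ?thesis by (simp add: P conj_transpose_product einstein_product_assoc)
qed

text \<open>With \<open>W = U\<^sup>H T\<close>, the form becomes \<open>W\<^sup>H D W\<close>. Its
  diagonal entry at \<open>k\<close> is the sum over \<open>j\<close> of \<open>D j j\<close> times
  the squared modulus of \<open>W j k\<close>. A vanishing sum of nonnegative terms has only zero
  terms, hence \<open>W = 0\<close> and \<open>T = U W = 0\<close>.\<close>

lemma hermitian_positive_definite_definite:
  assumes "hermitian_positive_definite I P" and T: "T \<in> tensors I"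
    and 0: "conj_transpose T \<star>\<^bsub>I\<^esub> P \<star>\<^bsub>I\<^esub> T = 0"
  shows "T = 0"
proof -
  obtain U D where U: "unitary_tensor I U" and D: "diagonal_tensor I D"
    and pos: "\<And>i. i \<in> multi_indices I \<Longrightarrow> \<exists>r::real. r > 0 \<and> D i i = of_real r"
    and P: "P = U \<star>\<^bsub>I\<^esub> D \<star>\<^bsub>I\<^esub> conj_transpose U"
    using assms by (auto simp: hermitian_positive_definite_def)
  define W where "W = conj_transpose U \<star>\<^bsub>I\<^esub> T"
  have W: "W \<in> tensors I" using U T by (simp add: W_def unitary_tensor_def)
  have form: "conj_transpose W \<star>\<^bsub>I\<^esub> (D \<star>\<^bsub>I\<^esub> W) = 0"
    using 0 by (simp add: W_def P conj_transpose_product einstein_product_assoc)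
  have "W i k = 0" for i k
  proof (cases "i \<in> multi_indices I")
    case True
    have "(\<Sum>j\<in>multi_indices I. Re (D j j) * (cmod (W j k))\<^sup>2)
        = Re ((conj_transpose W \<star>\<^bsub>I\<^esub> (D \<star>\<^bsub>I\<^esub> W)) k k)"
      unfolding einstein_product_def[of "conj_transpose W"] Re_sum
    proof (rule sum.cong)
      fix j assume j: "j \<in> multi_indices I"
      obtain r :: real where "D j j = of_real r" using pos[OF j] by auto
      then show "Re (D j j) * (cmod (W j k))\<^sup>2 = Re (conj_transpose W k j * (D \<star>\<^bsub>I\<^esub> W) j k)"
        by (simp add: diagonal_product_left[OF D j] conj_transpose_def cmod_power2)
          (simp add: power2_eq_square algebra_simps)
    qed simp
    also have "\<dots> = 0" using form by simp
    finally have "Re (D i i) * (cmod (W i k))\<^sup>2 = 0"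
      using True pos by (subst (asm) sum_nonneg_eq_0_iff) (force simp: finite_multi_indices)+
    with pos[OF True] show ?thesis by auto
  next
    case False
    with W show ?thesis by (simp add: tensors_def)
  qed
  then have "W = 0" by (simp add: fun_eq_iff)
  moreover have "T = U \<star>\<^bsub>I\<^esub> W"
    using U T by (simp add: W_def unitary_tensor_def flip: einstein_product_assoc)
  ultimately show ?thesis by simp
qed

text \<open>The inverse is \<open>U D\<^sup>-\<^sup>1 U\<^sup>H\<close>, which has the same spectral
  form with reciprocal, still positive, diagonal entries.\<close>

lemma hermitian_positive_definite_inverse:
  assumes "hermitian_positive_definite I P"
  obtains Q where "Q \<in> tensors I" "hermitian_positive_definite I Q"
    "P \<star>\<^bsub>I\<^esub> Q = identity_tensor I" "Q \<star>\<^bsub>I\<^esub> P = identity_tensor I"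
proof -
  obtain U D where U: "unitary_tensor I U" and D: "diagonal_tensor I D"
    and pos: "\<And>i. i \<in> multi_indices I \<Longrightarrow> \<exists>r::real. r > 0 \<and> D i i = of_real r"
    and P: "P = U \<star>\<^bsub>I\<^esub> D \<star>\<^bsub>I\<^esub> conj_transpose U"
    using assms by (auto simp: hermitian_positive_definite_def)
  \<comment> \<open>Because \<open>inverse 0 = 0\<close>, inverting entry by entry keeps the zeros
    off the diagonal and off the index range, so \<open>E\<close> is again a diagonal
    tensor.\<close>
  define E where "E = (\<lambda>i j. inverse (D i j))"
  define Q where "Q = U \<star>\<^bsub>I\<^esub> E \<star>\<^bsub>I\<^esub> conj_transpose U"
  have E: "diagonal_tensor I E"
    using D by (simp add: diagonal_tensor_def tensors_def E_def)
  have posE: "\<exists>r::real. r > 0 \<and> E i i = of_real r" if "i \<in> multi_indices I" for i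
    using pos[OF that] by (metis E_def of_real_inverse positive_imp_inverse_positive)
  have unit: "X \<star>\<^bsub>I\<^esub> Z = identity_tensor I"
    if "diagonal_tensor I X" "diagonal_tensor I Z" "\<And>i. i \<in> multi_indices I \<Longrightarrow> X i i * Z i i = 1"
    for X Z
  proof (intro ext)
    fix i k
    show "(X \<star>\<^bsub>I\<^esub> Z) i k = identity_tensor I i k"
    proof (cases "i \<in> multi_indices I")
      case True
      with that diagonal_product_left[OF that(1) True] show ?thesis
        by (cases "k \<in> multi_indices I")
          (auto simp: identity_tensor_eq diagonal_tensor_def tensors_def)
    next
      case False
      with that(1) show ?thesis
        by (auto simp: einstein_product_def identity_tensor_eq diagonal_tensor_def tensors_def)
    qed
  qed
  have nz: "D i i \<noteq> 0" if "i \<in> multi_indices I" for i using pos[OF that] by auto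
  have DE: "D \<star>\<^bsub>I\<^esub> E = identity_tensor I" "E \<star>\<^bsub>I\<^esub> D = identity_tensor I"
    using D E nz by (auto intro!: unit simp: E_def)
  have UU: "conj_transpose U \<star>\<^bsub>I\<^esub> U = identity_tensor I" "U \<star>\<^bsub>I\<^esub> conj_transpose U = identity_tensor I"
    and ten: "U \<in> tensors I" "D \<in> tensors I" "E \<in> tensors I"
    using U D E by (auto simp: unitary_tensor_def diagonal_tensor_def)
  have telescope: "U \<star>\<^bsub>I\<^esub> X \<star>\<^bsub>I\<^esub> conj_transpose U \<star>\<^bsub>I\<^esub> (U \<star>\<^bsub>I\<^esub> Z \<star>\<^bsub>I\<^esub> conj_transpose U)
      = identity_tensor I"
    if XZ: "X \<in> tensors I" "Z \<in> tensors I" "X \<star>\<^bsub>I\<^esub> Z = identity_tensor I" for X Z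
  proof -
    have "U \<star>\<^bsub>I\<^esub> X \<star>\<^bsub>I\<^esub> conj_transpose U \<star>\<^bsub>I\<^esub> (U \<star>\<^bsub>I\<^esub> Z \<star>\<^bsub>I\<^esub> conj_transpose U)
        = U \<star>\<^bsub>I\<^esub> (X \<star>\<^bsub>I\<^esub> (conj_transpose U \<star>\<^bsub>I\<^esub> U) \<star>\<^bsub>I\<^esub> Z) \<star>\<^bsub>I\<^esub> conj_transpose U"
      by (simp only: einstein_product_assoc)
    then show ?thesis using XZ ten UU by simp
  qed
  show thesis
  proof
    show "Q \<in> tensors I" using ten by (simp add: Q_def)
    show "hermitian_positive_definite I Q"
      using U E posE unfolding hermitian_positive_definite_def Q_def by blast
    show "P \<star>\<^bsub>I\<^esub> Q = identity_tensor I" "Q \<star>\<^bsub>I\<^esub> P = identity_tensor I"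
      using telescope ten DE by (simp_all add: P Q_def)
  qed
qed

text \<open>For \<open>T = A (V - W)\<close> the hypothesis makes \<open>T\<^sup>H P T\<close>
  vanish, so definiteness gives \<open>T = 0\<close>. In effect \<open>A\<^sup>H P\<close> is
  cancelled on the left.\<close>

lemma hermitian_positive_definite_cancel:
  assumes P: "hermitian_positive_definite I P"
    and ten: "A \<in> tensors I" "V \<in> tensors I" "W \<in> tensors I"
    and eq: "conj_transpose A \<star>\<^bsub>I\<^esub> P \<star>\<^bsub>I\<^esub> A \<star>\<^bsub>I\<^esub> V = conj_transpose A \<star>\<^bsub>I\<^esub> P \<star>\<^bsub>I\<^esub> A \<star>\<^bsub>I\<^esub> W"
  shows "A \<star>\<^bsub>I\<^esub> V = A \<star>\<^bsub>I\<^esub> W"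
proof -
  have "conj_transpose (A \<star>\<^bsub>I\<^esub> (V - W)) \<star>\<^bsub>I\<^esub> P \<star>\<^bsub>I\<^esub> (A \<star>\<^bsub>I\<^esub> (V - W))
      = conj_transpose (V - W) \<star>\<^bsub>I\<^esub> (conj_transpose A \<star>\<^bsub>I\<^esub> P \<star>\<^bsub>I\<^esub> A \<star>\<^bsub>I\<^esub> (V - W))"
    by (simp only: conj_transpose_product einstein_product_assoc)
  also have "\<dots> = 0"
    by (simp only: einstein_product_diff_right eq) simp
  finally have "A \<star>\<^bsub>I\<^esub> (V - W) = 0"
    by (rule hermitian_positive_definite_definite[OF P, rotated]) (simp add: ten)
  then show ?thesis by (simp add: einstein_product_diff_right)
qed

section \<open>Existence of the weighted Moore-Penrose inverse\<close>

lemma weighted_inner_inverse_exists: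
  assumes P: "hermitian_positive_definite I P" "P \<in> tensors I" and A: "A \<in> tensors I"
  obtains Y where "Y \<in> tensors I" "A \<star>\<^bsub>I\<^esub> Y \<star>\<^bsub>I\<^esub> A = A"
    "conj_transpose (P \<star>\<^bsub>I\<^esub> A \<star>\<^bsub>I\<^esub> Y) = P \<star>\<^bsub>I\<^esub> A \<star>\<^bsub>I\<^esub> Y"
proof -
  define G where "G = conj_transpose A \<star>\<^bsub>I\<^esub> P \<star>\<^bsub>I\<^esub> A"
  have herm: "conj_transpose P = P"
    using P by (simp add: hermitian_positive_definite_conj_transpose)
  have G: "G \<in> tensors I" using P A by (simp add: G_def)
  have Gh: "conj_transpose G = G"
    by (simp add: G_def conj_transpose_product einstein_product_assoc herm)
  obtain Y where Y: "Y \<in> tensors I" "G \<star>\<^bsub>I\<^esub> Y \<star>\<^bsub>I\<^esub> G = G"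
    using inner_inverse_exists[OF G] by blast
  \<comment> \<open>\<open>Y\<close> itself may fail to be Hermitian. As \<open>G\<close> is
    Hermitian, \<open>Y\<^sup>H\<close> is a second inner inverse of \<open>G\<close>, and
    cancellation is applied to both.\<close>
  define Z where "Z = conj_transpose Y"
  have Z: "Z \<in> tensors I" "G \<star>\<^bsub>I\<^esub> Z \<star>\<^bsub>I\<^esub> G = G"
    using Y(1) arg_cong[OF Y(2), of conj_transpose]
    by (simp_all add: Z_def conj_transpose_product einstein_product_assoc Gh)
  have cancel: "A \<star>\<^bsub>I\<^esub> (X \<star>\<^bsub>I\<^esub> G) = A" if "X \<in> tensors I" "G \<star>\<^bsub>I\<^esub> X \<star>\<^bsub>I\<^esub> G = G" for X
  proof -
    \<comment> \<open>The equation \<open>G X G = G\<close> reads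
      \<open>A\<^sup>H P A (X G) = A\<^sup>H P A\<close> times the identity, from which
      \<open>A\<^sup>H P\<close> cancels.\<close>
    have "A \<star>\<^bsub>I\<^esub> (X \<star>\<^bsub>I\<^esub> G) = A \<star>\<^bsub>I\<^esub> identity_tensor I"
      by (rule hermitian_positive_definite_cancel[OF P(1) A])
        (use that G in \<open>simp_all flip: G_def einstein_product_assoc\<close>)
    with A show ?thesis by simp
  qed
  have AYG: "A \<star>\<^bsub>I\<^esub> (Y \<star>\<^bsub>I\<^esub> G) = A" and GYA: "G \<star>\<^bsub>I\<^esub> Y \<star>\<^bsub>I\<^esub> conj_transpose A = conj_transpose A"
    using cancel[OF Y] arg_cong[OF cancel[OF Z], of conj_transpose]
    by (simp_all add: Z_def conj_transpose_product Gh)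
  let ?Y = "Y \<star>\<^bsub>I\<^esub> conj_transpose A \<star>\<^bsub>I\<^esub> P"
  \<comment> \<open>The adjoint of \<open>P A Y A\<^sup>H P\<close> has \<open>Z\<close> in place of
    \<open>Y\<close>. Replacing \<open>A\<^sup>H\<close> by \<open>G Y A\<^sup>H\<close> and then
    \<open>A Z G\<close> by \<open>A\<close> turns \<open>Z\<close> back into
    \<open>Y\<close>.\<close>
  have "conj_transpose (P \<star>\<^bsub>I\<^esub> A \<star>\<^bsub>I\<^esub> ?Y)
      = P \<star>\<^bsub>I\<^esub> A \<star>\<^bsub>I\<^esub> Z \<star>\<^bsub>I\<^esub> conj_transpose A \<star>\<^bsub>I\<^esub> P"
    by (simp add: Z_def conj_transpose_product einstein_product_assoc herm)
  also have "\<dots> = P \<star>\<^bsub>I\<^esub> A \<star>\<^bsub>I\<^esub> Z \<star>\<^bsub>I\<^esub> (G \<star>\<^bsub>I\<^esub> Y \<star>\<^bsub>I\<^esub> conj_transpose A) \<star>\<^bsub>I\<^esub> P"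
    by (simp only: GYA)
  also have "\<dots> = P \<star>\<^bsub>I\<^esub> (A \<star>\<^bsub>I\<^esub> (Z \<star>\<^bsub>I\<^esub> G)) \<star>\<^bsub>I\<^esub> Y \<star>\<^bsub>I\<^esub> conj_transpose A \<star>\<^bsub>I\<^esub> P"
    by (simp only: einstein_product_assoc)
  also have "\<dots> = P \<star>\<^bsub>I\<^esub> A \<star>\<^bsub>I\<^esub> ?Y"
    by (simp only: cancel[OF Z] einstein_product_assoc)
  finally have "conj_transpose (P \<star>\<^bsub>I\<^esub> A \<star>\<^bsub>I\<^esub> ?Y) = P \<star>\<^bsub>I\<^esub> A \<star>\<^bsub>I\<^esub> ?Y" .
  moreover have "A \<star>\<^bsub>I\<^esub> ?Y \<star>\<^bsub>I\<^esub> A = A"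
    using AYG by (simp add: G_def einstein_product_assoc)
  moreover have "?Y \<in> tensors I" using Y P A by simp
  ultimately show thesis using that by blast
qed

lemma weighted_mp_inverse_exists:
  assumes "M \<in> tensors I" "hermitian_positive_definite I M"
    and "N \<in> tensors I" "hermitian_positive_definite I N" and A: "A \<in> tensors I"
  obtains X where "is_weighted_mp_inverse I M N A X"
proof -
  obtain Y where Y: "Y \<in> tensors I" "A \<star>\<^bsub>I\<^esub> Y \<star>\<^bsub>I\<^esub> A = A"
    "conj_transpose (M \<star>\<^bsub>I\<^esub> A \<star>\<^bsub>I\<^esub> Y) = M \<star>\<^bsub>I\<^esub> A \<star>\<^bsub>I\<^esub> Y"
    using weighted_inner_inverse_exists assms by blast
  obtain Q where Q: "Q \<in> tensors I" "hermitian_positive_definite I Q"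
    "N \<star>\<^bsub>I\<^esub> Q = identity_tensor I" "Q \<star>\<^bsub>I\<^esub> N = identity_tensor I"
    using hermitian_positive_definite_inverse assms by blast
  obtain W where W: "W \<in> tensors I" "conj_transpose A \<star>\<^bsub>I\<^esub> W \<star>\<^bsub>I\<^esub> conj_transpose A = conj_transpose A"
    "conj_transpose (Q \<star>\<^bsub>I\<^esub> conj_transpose A \<star>\<^bsub>I\<^esub> W) = Q \<star>\<^bsub>I\<^esub> conj_transpose A \<star>\<^bsub>I\<^esub> W"
    using weighted_inner_inverse_exists[OF Q(2,1) conj_transpose_in_tensors[OF A]] by blast
  \<comment> \<open>Taking adjoints carries the inner inverse \<open>W\<close> of
    \<open>A\<^sup>H\<close> to an inner inverse of \<open>A\<close>, and the condition on
    \<open>Q A\<^sup>H W\<close> says that \<open>Z A Q\<close> is Hermitian.\<close>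
  define Z where "Z = conj_transpose W"
  have Z: "Z \<in> tensors I" "A \<star>\<^bsub>I\<^esub> Z \<star>\<^bsub>I\<^esub> A = A"
    using W(1) arg_cong[OF W(2), of conj_transpose]
    by (simp_all add: Z_def conj_transpose_product einstein_product_assoc)
  have herm: "conj_transpose N = N" "conj_transpose Q = Q"
    using assms Q by (simp_all add: hermitian_positive_definite_conj_transpose)
  have ZAQ: "Z \<star>\<^bsub>I\<^esub> A \<star>\<^bsub>I\<^esub> Q = Q \<star>\<^bsub>I\<^esub> conj_transpose A \<star>\<^bsub>I\<^esub> W"
    using W(3) by (simp add: Z_def conj_transpose_product einstein_product_assoc herm)
  \<comment> \<open>Since \<open>Q\<close> inverts \<open>N\<close>,
    \<open>N Z A = N (Z A Q) N\<close>, a congruence of a Hermitian tensor by the Hermitian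
    \<open>N\<close>.\<close>
  have "N \<star>\<^bsub>I\<^esub> Z \<star>\<^bsub>I\<^esub> A = N \<star>\<^bsub>I\<^esub> (Z \<star>\<^bsub>I\<^esub> A \<star>\<^bsub>I\<^esub> (Q \<star>\<^bsub>I\<^esub> N))"
    using Z A by (simp add: Q einstein_product_assoc)
  also have "\<dots> = N \<star>\<^bsub>I\<^esub> (Z \<star>\<^bsub>I\<^esub> A \<star>\<^bsub>I\<^esub> Q) \<star>\<^bsub>I\<^esub> N"
    by (simp only: einstein_product_assoc)
  also have "\<dots> = N \<star>\<^bsub>I\<^esub> Q \<star>\<^bsub>I\<^esub> (conj_transpose A \<star>\<^bsub>I\<^esub> W \<star>\<^bsub>I\<^esub> N)"
    unfolding ZAQ by (simp only: einstein_product_assoc)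
  also have "\<dots> = conj_transpose (N \<star>\<^bsub>I\<^esub> Z \<star>\<^bsub>I\<^esub> A)"
    using A W assms
    by (simp add: Q Z_def conj_transpose_product herm) (simp add: einstein_product_assoc)
  finally have NZA: "conj_transpose (N \<star>\<^bsub>I\<^esub> Z \<star>\<^bsub>I\<^esub> A) = N \<star>\<^bsub>I\<^esub> Z \<star>\<^bsub>I\<^esub> A" ..
  \<comment> \<open>This product satisfies \<open>A ?X = A Y\<close> and \<open>?X A = Z A\<close>,
    so it inherits the condition for \<open>M\<close> from \<open>Y\<close> and the condition for
    \<open>N\<close> from \<open>Z\<close>.\<close>
  let ?X = "Z \<star>\<^bsub>I\<^esub> A \<star>\<^bsub>I\<^esub> Y"
  have AX: "A \<star>\<^bsub>I\<^esub> ?X = A \<star>\<^bsub>I\<^esub> Y"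
    using arg_cong[OF Z(2), of "\<lambda>T. T \<star>\<^bsub>I\<^esub> Y"] by (simp add: einstein_product_assoc)
  have XA: "?X \<star>\<^bsub>I\<^esub> A = Z \<star>\<^bsub>I\<^esub> A"
    using Y(2) by (simp add: einstein_product_assoc)
  have "is_weighted_mp_inverse I M N A ?X"
    unfolding is_weighted_mp_inverse_def
  proof (intro conjI)
    show "?X \<in> tensors I" using Y Z A by simp
    show "A \<star>\<^bsub>I\<^esub> ?X \<star>\<^bsub>I\<^esub> A = A" using AX Y by simp
    show "?X \<star>\<^bsub>I\<^esub> A \<star>\<^bsub>I\<^esub> ?X = ?X"
      using AX by (simp add: XA) (simp add: einstein_product_assoc)
    show "conj_transpose (M \<star>\<^bsub>I\<^esub> A \<star>\<^bsub>I\<^esub> ?X) = M \<star>\<^bsub>I\<^esub> A \<star>\<^bsub>I\<^esub> ?X"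
      using Y(3) AX by (simp add: einstein_product_assoc)
    show "conj_transpose (N \<star>\<^bsub>I\<^esub> ?X \<star>\<^bsub>I\<^esub> A) = N \<star>\<^bsub>I\<^esub> ?X \<star>\<^bsub>I\<^esub> A"
      using NZA XA by (simp add: einstein_product_assoc)
  qed
  then show thesis using that by blast
qed

section \<open>Uniqueness of the weighted Moore-Penrose inverse\<close>

lemma hermitian_positive_definite_left_cancel:
  assumes P: "hermitian_positive_definite I P" and "V \<in> tensors I" "W \<in> tensors I"
    and "P \<star>\<^bsub>I\<^esub> V = P \<star>\<^bsub>I\<^esub> W"
  shows "V = W"
  using hermitian_positive_definite_inverse[OF P] assms
  by (metis einstein_product_assoc identity_product_left)

text \<open>The hypotheses say that \<open>E\<close> and \<open>F\<close> are self-adjoint for the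
  form given by \<open>P\<close>, and the adjoint for that form reverses products.\<close>

lemma self_adjoint_product:
  assumes "conj_transpose P = P" "conj_transpose (P \<star>\<^bsub>I\<^esub> E) = P \<star>\<^bsub>I\<^esub> E"
    and "conj_transpose (P \<star>\<^bsub>I\<^esub> F) = P \<star>\<^bsub>I\<^esub> F"
  shows "conj_transpose (P \<star>\<^bsub>I\<^esub> (E \<star>\<^bsub>I\<^esub> F)) = P \<star>\<^bsub>I\<^esub> (F \<star>\<^bsub>I\<^esub> E)"
  using assms by (metis conj_transpose_product einstein_product_assoc)

lemma weighted_mp_inverse_unique:
  assumes M: "hermitian_positive_definite I M" and N: "hermitian_positive_definite I N"
    and A: "A \<in> tensors I"
    and X: "is_weighted_mp_inverse I M N A X" and Z: "is_weighted_mp_inverse I M N A Z"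
  shows "X = Z"
proof -
  have ten: "X \<in> tensors I" "Z \<in> tensors I"
    using X Z by (simp_all add: is_weighted_mp_inverse_def)
  have AXA: "A \<star>\<^bsub>I\<^esub> (X \<star>\<^bsub>I\<^esub> A) = A" "A \<star>\<^bsub>I\<^esub> (Z \<star>\<^bsub>I\<^esub> A) = A"
    and XAX: "X \<star>\<^bsub>I\<^esub> (A \<star>\<^bsub>I\<^esub> X) = X" "Z \<star>\<^bsub>I\<^esub> (A \<star>\<^bsub>I\<^esub> Z) = Z"
    and mx: "conj_transpose (M \<star>\<^bsub>I\<^esub> (A \<star>\<^bsub>I\<^esub> X)) = M \<star>\<^bsub>I\<^esub> (A \<star>\<^bsub>I\<^esub> X)"
    and mz: "conj_transpose (M \<star>\<^bsub>I\<^esub> (A \<star>\<^bsub>I\<^esub> Z)) = M \<star>\<^bsub>I\<^esub> (A \<star>\<^bsub>I\<^esub> Z)"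
    and nx: "conj_transpose (N \<star>\<^bsub>I\<^esub> (X \<star>\<^bsub>I\<^esub> A)) = N \<star>\<^bsub>I\<^esub> (X \<star>\<^bsub>I\<^esub> A)"
    and nz: "conj_transpose (N \<star>\<^bsub>I\<^esub> (Z \<star>\<^bsub>I\<^esub> A)) = N \<star>\<^bsub>I\<^esub> (Z \<star>\<^bsub>I\<^esub> A)"
    using X Z by (simp_all add: is_weighted_mp_inverse_def einstein_product_assoc)
  \<comment> \<open>\<open>A X\<close> and \<open>A Z\<close> are projectors onto the same range,
    self-adjoint for \<open>M\<close>. Each absorbs the other on its right, and taking the
    \<open>M\<close>-adjoint of one such identity forces equality.\<close>
  have "(A \<star>\<^bsub>I\<^esub> X) \<star>\<^bsub>I\<^esub> (A \<star>\<^bsub>I\<^esub> Z) = A \<star>\<^bsub>I\<^esub> Z" "(A \<star>\<^bsub>I\<^esub> Z) \<star>\<^bsub>I\<^esub> (A \<star>\<^bsub>I\<^esub> X) = A \<star>\<^bsub>I\<^esub> X"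
    by (metis AXA einstein_product_assoc)+
  then have "M \<star>\<^bsub>I\<^esub> (A \<star>\<^bsub>I\<^esub> X) = M \<star>\<^bsub>I\<^esub> (A \<star>\<^bsub>I\<^esub> Z)"
    using self_adjoint_product[OF hermitian_positive_definite_conj_transpose[OF M] mx mz] mz by simp
  then have AX: "A \<star>\<^bsub>I\<^esub> X = A \<star>\<^bsub>I\<^esub> Z"
    using hermitian_positive_definite_left_cancel[OF M] A ten by blast
  \<comment> \<open>Dually, \<open>X A\<close> and \<open>Z A\<close> have the same kernel, so the
    absorption goes the other way.\<close>
  have "(X \<star>\<^bsub>I\<^esub> A) \<star>\<^bsub>I\<^esub> (Z \<star>\<^bsub>I\<^esub> A) = X \<star>\<^bsub>I\<^esub> A" "(Z \<star>\<^bsub>I\<^esub> A) \<star>\<^bsub>I\<^esub> (X \<star>\<^bsub>I\<^esub> A) = Z \<star>\<^bsub>I\<^esub> A"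
    by (simp_all add: AXA einstein_product_assoc)
  then have "N \<star>\<^bsub>I\<^esub> (X \<star>\<^bsub>I\<^esub> A) = N \<star>\<^bsub>I\<^esub> (Z \<star>\<^bsub>I\<^esub> A)"
    using self_adjoint_product[OF hermitian_positive_definite_conj_transpose[OF N] nx nz] nx by simp
  then have XA: "X \<star>\<^bsub>I\<^esub> A = Z \<star>\<^bsub>I\<^esub> A"
    using hermitian_positive_definite_left_cancel[OF N] A ten by blast
  \<comment> \<open>\<open>X = X A X = X A Z = Z A Z = Z\<close>.\<close>
  show ?thesis by (metis AX XA XAX einstein_product_assoc)
qed

lemma weighted_mp_inverse_eqI:
  assumes "hermitian_positive_definite I M" "hermitian_positive_definite I N" "A \<in> tensors I"
    and "is_weighted_mp_inverse I M N A X"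
  shows "weighted_mp_inverse I M N A = X"
  unfolding weighted_mp_inverse_def
  using assms weighted_mp_inverse_unique by (intro the_equality) blast+

text \<open>Existence and uniqueness together make the description by \<open>THE\<close> denote a
  tensor with the defining properties.\<close>

lemma is_weighted_mp_inverse_weighted_mp_inverse:
  assumes "M \<in> tensors I" "hermitian_positive_definite I M"
    and "N \<in> tensors I" "hermitian_positive_definite I N" "A \<in> tensors I"
  shows "is_weighted_mp_inverse I M N A (weighted_mp_inverse I M N A)"
  using assms weighted_mp_inverse_exists weighted_mp_inverse_eqI by metis

section \<open>The reverse order law\<close>

theorem theorem4p3:
  fixes I :: "nat list" and A B M N :: tensor
  assumes "A \<in> tensors I" and "B \<in> tensors I"
    and "M \<in> tensors I" and "N \<in> tensors I"
    and "hermitian_positive_definite I M" and "hermitian_positive_definite I N"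
    and "A \<star>\<^bsub>I\<^esub> (B \<star>\<^bsub>I\<^esub> weighted_mp_inverse I M N B)
       = (B \<star>\<^bsub>I\<^esub> weighted_mp_inverse I M N B) \<star>\<^bsub>I\<^esub> A"
    and "weighted_mp_inverse I M N A \<star>\<^bsub>I\<^esub> (B \<star>\<^bsub>I\<^esub> weighted_mp_inverse I M N B)
       = (B \<star>\<^bsub>I\<^esub> weighted_mp_inverse I M N B) \<star>\<^bsub>I\<^esub> weighted_mp_inverse I M N A"
    and "conj_transpose (N \<star>\<^bsub>I\<^esub> weighted_mp_inverse I M N B \<star>\<^bsub>I\<^esub>
           weighted_mp_inverse I M N A \<star>\<^bsub>I\<^esub> A \<star>\<^bsub>I\<^esub> B)
       = N \<star>\<^bsub>I\<^esub> weighted_mp_inverse I M N B \<star>\<^bsub>I\<^esub>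
           weighted_mp_inverse I M N A \<star>\<^bsub>I\<^esub> A \<star>\<^bsub>I\<^esub> B"
  shows "weighted_mp_inverse I M N (A \<star>\<^bsub>I\<^esub> B)
       = weighted_mp_inverse I M N B \<star>\<^bsub>I\<^esub> weighted_mp_inverse I M N A"
proof -
  define X where "X = weighted_mp_inverse I M N B"
  define Y where "Y = weighted_mp_inverse I M N A"
  have X: "is_weighted_mp_inverse I M N B X" and Y: "is_weighted_mp_inverse I M N A Y"
    using assms by (simp_all add: X_def Y_def is_weighted_mp_inverse_weighted_mp_inverse)
  \<comment> \<open>\<open>P\<close> is the projector onto the range of \<open>B\<close>,
    self-adjoint for \<open>M\<close>. Hypotheses (i) and (ii) say that it commutes with
    \<open>A\<close> and with \<open>Y\<close>.\<close>
  define P where "P = B \<star>\<^bsub>I\<^esub> X"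
  have PA: "A \<star>\<^bsub>I\<^esub> P = P \<star>\<^bsub>I\<^esub> A" and PY: "Y \<star>\<^bsub>I\<^esub> P = P \<star>\<^bsub>I\<^esub> Y"
    using assms(7,8) by (simp_all add: P_def X_def Y_def)
  have PB: "P \<star>\<^bsub>I\<^esub> B = B" and XP: "X \<star>\<^bsub>I\<^esub> P = X"
    using X by (simp_all add: P_def is_weighted_mp_inverse_def einstein_product_assoc)
  have AYA: "A \<star>\<^bsub>I\<^esub> Y \<star>\<^bsub>I\<^esub> A = A" and YAY: "Y \<star>\<^bsub>I\<^esub> A \<star>\<^bsub>I\<^esub> Y = Y"
    using Y by (simp_all add: is_weighted_mp_inverse_def)
  have mP: "conj_transpose (M \<star>\<^bsub>I\<^esub> P) = M \<star>\<^bsub>I\<^esub> P"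
    and mAY: "conj_transpose (M \<star>\<^bsub>I\<^esub> (A \<star>\<^bsub>I\<^esub> Y)) = M \<star>\<^bsub>I\<^esub> (A \<star>\<^bsub>I\<^esub> Y)"
    using X Y by (simp_all add: P_def is_weighted_mp_inverse_def einstein_product_assoc)
  have comm: "P \<star>\<^bsub>I\<^esub> (A \<star>\<^bsub>I\<^esub> Y) = A \<star>\<^bsub>I\<^esub> Y \<star>\<^bsub>I\<^esub> P"
    by (metis PA PY einstein_product_assoc)
  \<comment> \<open>Regrouping gives \<open>A (B X) Y = A P Y\<close>, and \<open>P\<close> then
    moves to the left of \<open>A\<close>. All conditions that contain \<open>A B X Y\<close> reduce
    to this form.\<close>
  have ABXY: "A \<star>\<^bsub>I\<^esub> B \<star>\<^bsub>I\<^esub> (X \<star>\<^bsub>I\<^esub> Y) = P \<star>\<^bsub>I\<^esub> (A \<star>\<^bsub>I\<^esub> Y)"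
    by (metis PA P_def einstein_product_assoc)
  have "is_weighted_mp_inverse I M N (A \<star>\<^bsub>I\<^esub> B) (X \<star>\<^bsub>I\<^esub> Y)"
    unfolding is_weighted_mp_inverse_def
  proof (intro conjI)
    show "X \<star>\<^bsub>I\<^esub> Y \<in> tensors I"
      using X Y by (simp add: is_weighted_mp_inverse_def)
    have "A \<star>\<^bsub>I\<^esub> B \<star>\<^bsub>I\<^esub> (X \<star>\<^bsub>I\<^esub> Y) \<star>\<^bsub>I\<^esub> (A \<star>\<^bsub>I\<^esub> B) = P \<star>\<^bsub>I\<^esub> (A \<star>\<^bsub>I\<^esub> Y \<star>\<^bsub>I\<^esub> A) \<star>\<^bsub>I\<^esub> B"
      unfolding ABXY by (simp only: einstein_product_assoc)
    \<comment> \<open>After \<open>A Y A\<close> shrinks to \<open>A\<close>, moving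
      \<open>P\<close> back across \<open>A\<close> lets \<open>B\<close> absorb it.\<close>
    also have "\<dots> = A \<star>\<^bsub>I\<^esub> (P \<star>\<^bsub>I\<^esub> B)"
      by (simp only: AYA flip: PA) (simp only: einstein_product_assoc)
    finally show "A \<star>\<^bsub>I\<^esub> B \<star>\<^bsub>I\<^esub> (X \<star>\<^bsub>I\<^esub> Y) \<star>\<^bsub>I\<^esub> (A \<star>\<^bsub>I\<^esub> B) = A \<star>\<^bsub>I\<^esub> B"
      by (simp only: PB)
    have "X \<star>\<^bsub>I\<^esub> Y \<star>\<^bsub>I\<^esub> (A \<star>\<^bsub>I\<^esub> B) \<star>\<^bsub>I\<^esub> (X \<star>\<^bsub>I\<^esub> Y) = X \<star>\<^bsub>I\<^esub> (Y \<star>\<^bsub>I\<^esub> P) \<star>\<^bsub>I\<^esub> (A \<star>\<^bsub>I\<^esub> Y)"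
      using ABXY by (simp only: einstein_product_assoc)
    also have "\<dots> = X \<star>\<^bsub>I\<^esub> P \<star>\<^bsub>I\<^esub> (Y \<star>\<^bsub>I\<^esub> A \<star>\<^bsub>I\<^esub> Y)"
      by (simp only: PY einstein_product_assoc)
    finally show "X \<star>\<^bsub>I\<^esub> Y \<star>\<^bsub>I\<^esub> (A \<star>\<^bsub>I\<^esub> B) \<star>\<^bsub>I\<^esub> (X \<star>\<^bsub>I\<^esub> Y) = X \<star>\<^bsub>I\<^esub> Y"
      by (simp only: XP YAY)
    \<comment> \<open>\<open>P\<close> and \<open>A Y\<close> are both self-adjoint for
      \<open>M\<close> and commute, so their product is self-adjoint for \<open>M\<close>
      too.\<close>
    have "conj_transpose (M \<star>\<^bsub>I\<^esub> (P \<star>\<^bsub>I\<^esub> (A \<star>\<^bsub>I\<^esub> Y))) = M \<star>\<^bsub>I\<^esub> (P \<star>\<^bsub>I\<^esub> (A \<star>\<^bsub>I\<^esub> Y))"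
      using self_adjoint_product[OF hermitian_positive_definite_conj_transpose[OF assms(5)] mP mAY]
      by (simp only: comm)
    then show "conj_transpose (M \<star>\<^bsub>I\<^esub> (A \<star>\<^bsub>I\<^esub> B) \<star>\<^bsub>I\<^esub> (X \<star>\<^bsub>I\<^esub> Y)) = M \<star>\<^bsub>I\<^esub> (A \<star>\<^bsub>I\<^esub> B) \<star>\<^bsub>I\<^esub> (X \<star>\<^bsub>I\<^esub> Y)"
      by (simp only: einstein_product_assoc[of M] ABXY)
    \<comment> \<open>Up to bracketing this is hypothesis (iii).\<close>
    show "conj_transpose (N \<star>\<^bsub>I\<^esub> (X \<star>\<^bsub>I\<^esub> Y) \<star>\<^bsub>I\<^esub> (A \<star>\<^bsub>I\<^esub> B)) = N \<star>\<^bsub>I\<^esub> (X \<star>\<^bsub>I\<^esub> Y) \<star>\<^bsub>I\<^esub> (A \<star>\<^bsub>I\<^esub> B)"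
      using assms(9) by (simp only: X_def Y_def einstein_product_assoc)
  qed
  then show ?thesis
    using assms weighted_mp_inverse_eqI by (simp add: X_def Y_def)
qed

end
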